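(* Let $\ell>0$, $g>0$, $T>0$, and let $f\colon\mathbb R\to\mathbb R^2$ be a $T$-periodic function of class $C^3$. Then the planar Whitney inverted pendulum problem has a $T$-periodic solution, i.e. there exists a $T$-periodic $C^2$ function $x\colon\mathbb R\to\{z\in\mathbb R^2: |z|<\ell\}$ satisfying \[ \ddot x=\frac{1}{\ell^2}\left(g\sqrt{\ell^2-|x|^2}-\frac{(x^T\dot x)^2}{\ell^2-|x|^2}-|\dot x|^2\right)x+\frac{x^T\ddot f(t)}{\ell^2}\,x-\ddot f(t)\quad\text{for all }t\in\mathbb R. \]
   Context: The planar Whitney inverted pendulum problem: a rod of length $\ell$, with its whole mass concentrated at its top, is attached by a frictionless pivot to the floor of a car moving in the horizontal plane, the pivot being at position $f(t)\in\mathbb R^2$ at time $t$; the rod can fall in any direction and moves under gravity (gravitational constant $g$) and the motion of the car. Writing $x(t)\in\mathbb R^2$ for the horizontal position of the top of the rod relative to the pivot (so its height is $\sqrt{\ell^2-|x(t)|^2}$), Newton's law gives the displayed differential equation. Here $|\cdot|$ is the Euclidean norm and $x^Ty$ the scalar product. A solution for which the rod never touches the floor is one with $|x(t)|<\ell$ for all $t$; a $T$-periodic solution of the problem is such a solution which is $T$-periodic. *)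

theory Defs
  imports "HOL-Analysis.Analysis"
begin

definition C2_fun :: "(real \<Rightarrow> real^2) \<Rightarrow> (real \<Rightarrow> real^2) \<Rightarrow> (real \<Rightarrow> real^2) \<Rightarrow> bool" where
  "C2_fun u u1 u2 \<longleftrightarrow>
     (\<forall>t. (u has_vector_derivative u1 t) (at t)) \<and>
     (\<forall>t. (u1 has_vector_derivative u2 t) (at t)) \<and>
     continuous_on UNIV u2"

definition C3_fun :: "(real \<Rightarrow> real^2) \<Rightarrow> bool" where
  "C3_fun u \<longleftrightarrow> (\<exists>u1 u2 u3.
     (\<forall>t. (u has_vector_derivative u1 t) (at t)) \<and>
     (\<forall>t. (u1 has_vector_derivative u2 t) (at t)) \<and>
     (\<forall>t. (u2 has_vector_derivative u3 t) (at t)) \<and>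
     continuous_on UNIV u3)"

end

(* In the gnomonic chart y = x / h, where h = sqrt (l^2 - |x|^2) is the height of the top of the
   rod, great circles become lines, and the equation of motion reads
     y' = p / h^2,   p' = h (g y - f''),   h = l / sqrt (1 + |y|^2),
   on the whole space, without singularity. If |f''_k| < g M for all k, then p_k' and y_k have the
   same sign wherever |y_k| >= M. Truncate the system to make it globally Lipschitz with bounded
   right-hand side. On a large box of initial values (y, p), the sign conditions of the
   Poincare-Miranda theorem hold for the time-T displacement of p against y and of y against p,
   which gives a T-periodic solution; at a maximum of y_k the sign of p_k' forces y_k <= M
   (likewise for -y_k), so that the truncation was inactive. *)

theory Submission
  imports Defs "HOL-Library.Periodic_Fun"
begin

subsection \<open>The flow of a Lipschitz field\<close>

text \<open>The curves are stored divided by \<open>exp (2 * K * r)\<close>. The integrands then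
  differ by at most \<open>K * exp (2 * K * r) * d\<close>, whose integral is
  \<open>(exp (2 * K * s) - 1) * d / 2\<close>; the outer weight cancels the growth. The factor 2 in
  the exponent produces the contraction constant 1/2, whatever the length of the interval.\<close>

lemma weighted_integral_contraction:
  fixes F :: "real \<Rightarrow> 'a::euclidean_space \<Rightarrow> 'a" and v w :: "real \<Rightarrow> 'a"
  assumes cont: "continuous_on UNIV (\<lambda>(t, u). F t u)"
    and lip: "\<And>t u v. norm (F t u - F t v) \<le> K * norm (u - v)" and K: "K > 0"
    and v: "continuous_on UNIV v" and w: "continuous_on UNIV w"
    and d: "\<And>t. dist (v t) (w t) \<le> d" and s: "s \<ge> 0"
  shows "norm (exp (- (2 * K * s)) *\<^sub>R (integral {0..s} (\<lambda>r. F r (exp (2 * K * r) *\<^sub>R v r))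
            - integral {0..s} (\<lambda>r. F r (exp (2 * K * r) *\<^sub>R w r)))) \<le> d / 2"
proof -
  have c: "continuous_on {0..s} (\<lambda>r. F r (exp (2 * K * r) *\<^sub>R x r))" if "continuous_on UNIV x" for x
  proof -
    have "continuous_on {0..s} ((\<lambda>(t, u). F t u) \<circ> (\<lambda>r. (r, exp (2 * K * r) *\<^sub>R x r)))"
      by (intro continuous_on_compose continuous_on_subset[OF cont] continuous_intros
            continuous_on_subset[OF that]) auto
    then show ?thesis by (simp add: o_def)
  qed
  have "norm (F r (exp (2 * K * r) *\<^sub>R v r) - F r (exp (2 * K * r) *\<^sub>R w r)) \<le> K * exp (2 * K * r) * d" for r
  proof -
    have "norm (F r (exp (2 * K * r) *\<^sub>R v r) - F r (exp (2 * K * r) *\<^sub>R w r))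
        \<le> K * norm (exp (2 * K * r) *\<^sub>R (v r - w r))"
      using lip[of r "exp (2 * K * r) *\<^sub>R v r" "exp (2 * K * r) *\<^sub>R w r"] by (simp add: scaleR_diff_right)
    also have "\<dots> = (K * exp (2 * K * r)) * norm (v r - w r)" by simp
    also have "\<dots> \<le> (K * exp (2 * K * r)) * d"
      using d[of r] K by (intro mult_left_mono) (auto simp: dist_norm)
    finally show ?thesis .
  qed
  moreover have I: "((\<lambda>r. K * exp (2 * K * r) * d) has_integral (exp (2 * K * s) * d / 2 - exp (2 * K * 0) * d / 2)) {0..s}"
    by (rule fundamental_theorem_of_calculus)
      (use s in \<open>auto intro!: derivative_eq_intros simp: has_real_derivative_iff_has_vector_derivative[symmetric]\<close>)
  ultimately have "norm (integral {0..s} (\<lambda>r. F r (exp (2 * K * r) *\<^sub>R v r) - F r (exp (2 * K * r) *\<^sub>R w r)))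
      \<le> integral {0..s} (\<lambda>r. K * exp (2 * K * r) * d)"
    by (intro integral_norm_bound_integral integrable_diff integrable_continuous_real c v w)
      (auto intro!: continuous_intros)
  also have "\<dots> = exp (2 * K * s) * d / 2 - d / 2"
    using integral_unique[OF I] by simp
  finally have *: "norm (integral {0..s} (\<lambda>r. F r (exp (2 * K * r) *\<^sub>R v r))
       - integral {0..s} (\<lambda>r. F r (exp (2 * K * r) *\<^sub>R w r))) \<le> exp (2 * K * s) * d / 2 - d / 2"
    by (simp add: integral_diff integrable_continuous_real c v w)
  have "0 \<le> d" using d[of 0] zero_le_dist order_trans by blast
  have "exp (- (2 * K * s)) * norm (integral {0..s} (\<lambda>r. F r (exp (2 * K * r) *\<^sub>R v r))
       - integral {0..s} (\<lambda>r. F r (exp (2 * K * r) *\<^sub>R w r)))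
     \<le> exp (- (2 * K * s)) * (exp (2 * K * s) * d / 2 - d / 2)"
    using * by (intro mult_left_mono) auto
  also have "\<dots> = d / 2 - exp (- (2 * K * s)) * (d / 2)"
    by (simp add: exp_minus field_simps)
  also have "\<dots> \<le> d / 2" using \<open>0 \<le> d\<close> by simp
  finally show ?thesis by simp
qed

text \<open>Picard's operator contracts in the exponentially weighted sup norm, so a single
  application of Banach's fixed point theorem covers all of \<open>{0..T}\<close>, and the same
  estimate yields Lipschitz dependence on the initial value.\<close>

lemma lipschitz_ode_flow:
  fixes F :: "real \<Rightarrow> 'a::euclidean_space \<Rightarrow> 'a"
  assumes cont: "continuous_on UNIV (\<lambda>(t, u). F t u)"
    and lip: "\<And>t u v. norm (F t u - F t v) \<le> K * norm (u - v)" and K: "K > 0" and T: "T > 0"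
  obtains \<phi> where "\<And>c. \<phi> c 0 = c"
    "\<And>c t. t \<in> {0..T} \<Longrightarrow> (\<phi> c has_vector_derivative F t (\<phi> c t)) (at t within {0..T})"
    "continuous_on UNIV (\<lambda>c. \<phi> c T)"
proof -
  \<comment> \<open>Time is clamped to \<open>{0..T}\<close>, so that the weighted Picard iterates
    become bounded continuous functions on the whole line, the elements of the complete space
    \<open>bcontfun\<close>.\<close>
  define \<sigma> where "\<sigma> t = max 0 (min T t)" for t
  have \<sigma>: "\<sigma> t \<in> {0..T}" for t using T by (auto simp: \<sigma>_def)
  define I where "I v s = integral {0..s} (\<lambda>r. F r (exp (2 * K * r) *\<^sub>R v r))" for v :: "real \<Rightarrow> 'a" and s
  define \<Psi> where "\<Psi> c v t = exp (- (2 * K * \<sigma> t)) *\<^sub>R (c + I v (\<sigma> t))" for c v t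
  have cF: "continuous_on S (\<lambda>r. F r (x r))" if "continuous_on S x" for x S
  proof -
    have "continuous_on S ((\<lambda>(t, u). F t u) \<circ> (\<lambda>r. (r, x r)))"
      by (intro continuous_on_compose continuous_on_subset[OF cont] continuous_intros that) auto
    then show ?thesis by (simp add: o_def)
  qed
  have dI: "(I v has_vector_derivative F t (exp (2 * K * t) *\<^sub>R v t)) (at t within {0..T})"
    if "continuous_on UNIV v" "t \<in> {0..T}" for v t
    unfolding I_def
    by (intro integral_has_vector_derivative cF continuous_intros that continuous_on_subset[OF that(1)]) auto
  have cI: "continuous_on {0..T} (I v)" if "continuous_on UNIV v" for v
    by (intro continuous_on_vector_derivative) (use dI that in auto)
  have bc: "\<Psi> c v \<in> bcontfun" if v: "continuous_on UNIV v" for c v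
  proof -
    have c1: "continuous_on {0..T} (\<lambda>t. exp (- (2 * K * t)) *\<^sub>R (c + I v t))"
      by (intro continuous_intros cI v)
    have "continuous_on UNIV ((\<lambda>t. exp (- (2 * K * t)) *\<^sub>R (c + I v t)) \<circ> \<sigma>)"
      by (intro continuous_on_compose continuous_on_subset[OF c1])
        (use \<sigma> in \<open>auto simp: \<sigma>_def intro!: continuous_intros\<close>)
    then have "continuous_on UNIV (\<Psi> c v)" by (simp add: \<Psi>_def[abs_def] o_def)
    moreover have "bounded (range (\<Psi> c v))"
    proof (rule bounded_subset[OF compact_imp_bounded[OF compact_continuous_image[OF c1]]])
      show "range (\<Psi> c v) \<subseteq> (\<lambda>t. exp (- (2 * K * t)) *\<^sub>R (c + I v t)) ` {0..T}"
        using \<sigma> by (auto simp: \<Psi>_def)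
    qed simp
    ultimately show ?thesis by (simp add: bcontfun_def)
  qed
  define \<Theta> where "\<Theta> c v = Bcontfun (\<Psi> c (apply_bcontfun v))" for c v
  have ap: "apply_bcontfun (\<Theta> c v) = \<Psi> c v" for c v
    by (simp add: \<Theta>_def Bcontfun_inverse bc)
  \<comment> \<open>Used twice: with equal initial values it is the contraction property; at two
    fixed points the term \<open>1/2 * dist v w\<close> is absorbed into the left side, which leaves
    the Lipschitz constant 2.\<close>
  have est: "dist (\<Theta> c v) (\<Theta> d w) \<le> 1/2 * dist v w + norm (c - d)" for c d v w
  proof (rule dist_bound)
    fix t
    let ?e = "exp (- (2 * K * \<sigma> t))"
    have "dist (\<Theta> c v t) (\<Theta> d w t) = norm (?e *\<^sub>R (I v (\<sigma> t) - I w (\<sigma> t)) + ?e *\<^sub>R (c - d))"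
      by (simp add: ap \<Psi>_def dist_norm algebra_simps)
    also have "\<dots> \<le> norm (?e *\<^sub>R (I v (\<sigma> t) - I w (\<sigma> t))) + norm (?e *\<^sub>R (c - d))"
      by (rule norm_triangle_ineq)
    also have "norm (?e *\<^sub>R (I v (\<sigma> t) - I w (\<sigma> t))) \<le> dist v w / 2"
      unfolding I_def using \<sigma>[of t]
      by (intro weighted_integral_contraction[OF cont lip K] dist_bounded) auto
    also have "norm (?e *\<^sub>R (c - d)) \<le> 1 * norm (c - d)"
      unfolding norm_scaleR using K \<sigma>[of t] by (intro mult_right_mono) auto
    finally show "dist (\<Theta> c v t) (\<Theta> d w t) \<le> 1/2 * dist v w + norm (c - d)" by simp
  qed
  have "\<exists>v. \<Theta> c v = v" for c
    using banach_fix_type[of "1/2" "\<Theta> c"] est[of c _ c] by auto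
  then obtain V where V: "\<And>c. \<Theta> c (V c) = V c" by metis
  have Vc: "dist (V c) (V d) \<le> 2 * norm (c - d)" for c d
    using est[of c "V c" d "V d"] V by simp
  \<comment> \<open>The integral form is differentiable at sight. It agrees with the unweighted
    fixed point only on \<open>{0..T}\<close>, where \<open>\<sigma>\<close> is the
    identity.\<close>
  define \<phi> where "\<phi> c t = c + I (V c) t" for c t
  have \<phi>: "\<phi> c t = exp (2 * K * t) *\<^sub>R V c t" if "t \<in> {0..T}" for c t
  proof -
    have "\<sigma> t = t" using that by (auto simp: \<sigma>_def)
    then have "V c t = exp (- (2 * K * t)) *\<^sub>R \<phi> c t"
      using fun_cong[OF ap[of c "V c"], of t] by (simp add: V \<Psi>_def \<phi>_def)
    then show ?thesis by (simp add: exp_minus)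
  qed
  show thesis
  proof
    show "\<phi> c 0 = c" for c by (simp add: \<phi>_def I_def)
    show "(\<phi> c has_vector_derivative F t (\<phi> c t)) (at t within {0..T})" if t: "t \<in> {0..T}" for c t
    proof -
      have "(\<phi> c has_vector_derivative F t (exp (2 * K * t) *\<^sub>R V c t)) (at t within {0..T})"
        unfolding \<phi>_def[abs_def] using dI[of "V c" t] t
        by (auto intro!: derivative_eq_intros)
      then show ?thesis by (simp add: \<phi>[OF t])
    qed
    have "(2 * exp (2 * K * T))-lipschitz_on UNIV (\<lambda>c. \<phi> c T)"
    proof (rule lipschitz_onI)
      fix c d
      have "dist (\<phi> c T) (\<phi> d T) = exp (2 * K * T) * dist (V c T) (V d T)"
        using T by (simp add: \<phi> dist_norm flip: scaleR_diff_right)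
      also have "\<dots> \<le> exp (2 * K * T) * (2 * dist c d)"
        using order_trans[OF dist_bounded Vc[of c d]] by (intro mult_left_mono) (auto simp: dist_norm)
      finally show "dist (\<phi> c T) (\<phi> d T) \<le> 2 * exp (2 * K * T) * dist c d" by simp
    qed simp
    then show "continuous_on UNIV (\<lambda>c. \<phi> c T)" by (rule lipschitz_on_continuous_on)
  qed
qed

subsection \<open>Poincare-Miranda theorem and periodic extension\<close>

text \<open>Brouwer's theorem applies to \<open>x - F x\<close> clamped to the box. If the clamping
  is active in coordinate \<open>i\<close> at the fixed point \<open>x\<close>, then
  \<open>x\<close> lies on a face and \<open>F x \<bullet> i\<close> has strictly the sign forbidden
  there; hence every coordinate of \<open>F x\<close> vanishes.\<close>

lemma poincare_miranda:
  fixes F :: "'a::euclidean_space \<Rightarrow> 'a"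
  assumes ab: "\<And>i. i \<in> Basis \<Longrightarrow> a \<bullet> i \<le> b \<bullet> i"
    and cont: "continuous_on (cbox a b) F"
    and lo: "\<And>x i. x \<in> cbox a b \<Longrightarrow> i \<in> Basis \<Longrightarrow> x \<bullet> i = a \<bullet> i \<Longrightarrow> F x \<bullet> i \<le> 0"
    and hi: "\<And>x i. x \<in> cbox a b \<Longrightarrow> i \<in> Basis \<Longrightarrow> x \<bullet> i = b \<bullet> i \<Longrightarrow> F x \<bullet> i \<ge> 0"
  obtains x where "x \<in> cbox a b" "F x = 0"
proof -
  have "continuous_on UNIV (clamp a b)"
    using clamp_continuous_on[of a b "\<lambda>x. x" UNIV] by simp
  then have c: "continuous_on (cbox a b) (\<lambda>x. clamp a b (x - F x))"
    by (rule continuous_on_compose2) (intro continuous_intros cont, simp)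
  have ne: "cbox a b \<noteq> {}" using ab by (simp add: box_ne_empty)
  have m: "(\<lambda>x. clamp a b (x - F x)) \<in> cbox a b \<rightarrow> cbox a b"
    using clamp_in_interval[OF ab] by blast
  obtain x where x: "x \<in> cbox a b" and fixpt: "clamp a b (x - F x) = x"
    by (rule brouwer[OF compact_cbox convex_box(1) ne c m])
  have "F x \<bullet> i = 0" if i: "i \<in> Basis" for i
  proof -
    have "x \<bullet> i = clamp a b (x - F x) \<bullet> i" using fixpt by simp
    also have "\<dots> = (if (x - F x) \<bullet> i < a \<bullet> i then a \<bullet> i
        else if (x - F x) \<bullet> i \<le> b \<bullet> i then (x - F x) \<bullet> i else b \<bullet> i)"
      using ab i by (simp add: clamp_def)
    finally consider "F x \<bullet> i > x \<bullet> i - a \<bullet> i" "x \<bullet> i = a \<bullet> i" | "F x \<bullet> i = 0"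
      | "F x \<bullet> i < x \<bullet> i - b \<bullet> i" "x \<bullet> i = b \<bullet> i"
      unfolding inner_diff_left by argo
    then show ?thesis using lo[OF x i] hi[OF x i] by cases linarith+
  qed
  then have "F x = 0" by (intro euclidean_eqI[where 'a='a]) simp
  then show thesis using x that by blast
qed

lemma has_vector_derivative_within_Un:
  assumes "(f has_vector_derivative D) (at x within S)" "(f has_vector_derivative D) (at x within S')"
  shows "(f has_vector_derivative D) (at x within S \<union> S')"
  using assms unfolding has_vector_derivative_def has_derivative_within
  by (auto intro: Lim_Un)

text \<open>On each closed period interval the extension is a translate of \<open>u\<close>. At a
  multiple of \<open>T\<close> two translates meet: \<open>u T = u 0\<close> makes their values
  match, \<open>w T = w 0\<close> their one-sided derivatives.\<close>

lemma periodic_extension_has_vector_derivative: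
  fixes u w :: "real \<Rightarrow> 'a::real_normed_vector"
  assumes T: "T > 0"
    and D: "\<And>t. t \<in> {0..T} \<Longrightarrow> (u has_vector_derivative w t) (at t within {0..T})"
    and per: "u T = u 0" "w T = w 0"
  shows "((\<lambda>t. u (T * frac (t / T))) has_vector_derivative w (T * frac (t / T))) (at t)"
proof -
  \<comment> \<open>At the right end point \<open>frac\<close> jumps back to 0 while the translate
    evaluates at \<open>T\<close>; the hypothesis \<open>x T = x 0\<close> reconciles the
    two.\<close>
  have eq: "x (T * frac (t / T)) = x (t - T * of_int k)"
    if x: "x T = x 0" and t: "t \<in> {T * of_int k .. T * of_int k + T}" for x :: "real \<Rightarrow> 'a" and k t
  proof (cases "t = T * of_int k + T")
    case True
    then have "t / T = of_int (k + 1)" using T by (simp add: field_simps)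
    then show ?thesis using True x by (simp del: of_int_add)
  next
    case False
    then have "floor (t / T) = k"
      using t T by (intro floor_unique) (auto simp: field_simps)
    then have "T * frac (t / T) = t - T * of_int k" using T by (simp add: frac_def right_diff_distrib)
    then show ?thesis by simp
  qed
  define U where "U t = u (T * frac (t / T))" for t
  have *: "(U has_vector_derivative w (T * frac (t / T))) (at t within {T * of_int k .. T * of_int k + T})"
    if t: "t \<in> {T * of_int k .. T * of_int k + T}" for k
  proof -
    let ?S = "{T * of_int k .. T * of_int k + T}"
    have im: "(\<lambda>s. s - T * of_int k) ` ?S = {0..T}"
      by simp
    have "((u \<circ> (\<lambda>s. s - T * of_int k)) has_vector_derivative (1 *\<^sub>R w (t - T * of_int k))) (at t within ?S)"
      using t im by (intro vector_diff_chain_within) (auto intro!: derivative_eq_intros D)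
    then have "((\<lambda>s. u (s - T * of_int k)) has_vector_derivative w (T * frac (t / T))) (at t within ?S)"
      by (simp add: o_def eq[OF per(2) t])
    then show ?thesis
      by (rule has_vector_derivative_transform[OF t, rotated]) (simp add: U_def eq[OF per(1), of _ k])
  qed
  define k where "k = floor (t / T)"
  have k: "T * of_int k \<le> t" "t < T * of_int k + T"
    using T floor_divide_lower[of T t] floor_divide_upper[of T t] by (simp_all add: k_def algebra_simps)
  have "(U has_vector_derivative w (T * frac (t / T))) (at t)"
  proof (cases "t = T * of_int k")
    case False
    then have "t \<in> interior {T * of_int k .. T * of_int k + T}" using k by simp
    then have "at t within {T * of_int k .. T * of_int k + T} = at t" by (rule at_within_interior)
    then show ?thesis using *[of k] k by simp
  next
    case True
    have "(U has_vector_derivative w (T * frac (t / T)))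
      (at t within {T * of_int (k - 1) .. T * of_int (k - 1) + T} \<union> {T * of_int k .. T * of_int k + T})"
      using True T by (intro has_vector_derivative_within_Un *) (auto simp: algebra_simps)
    also have "{T * of_int (k - 1) .. T * of_int (k - 1) + T} \<union> {T * of_int k .. T * of_int k + T} = {t - T .. t + T}"
      using True T by (auto simp: algebra_simps)
    also have "at t within {t - T .. t + T} = at t" using T by (intro at_within_interior) simp
    finally show ?thesis .
  qed
  then show ?thesis by (simp add: U_def[abs_def])
qed

subsection \<open>Periodic functions and truncation\<close>

lemma periodic_eq_frac:
  fixes f :: "real \<Rightarrow> 'a"
  assumes "T > 0" "\<And>t. f (t + T) = f t"
  shows "f (T * frac (t / T)) = f t"
proof -
  interpret periodic_fun_simple f T by standard (rule assms)
  have "T * frac (t / T) + of_int (floor (t / T)) * T = t"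
    using assms(1) by (simp add: frac_def algebra_simps)
  then show ?thesis by (metis plus_of_int)
qed

lemma periodic_continuous_attains_sup:
  fixes f :: "real \<Rightarrow> real"
  assumes T: "T > 0" and per: "\<And>t. f (t + T) = f t" and cont: "continuous_on UNIV f"
  obtains s where "\<And>t. f t \<le> f s"
proof -
  have "continuous_on {0..T} f" using cont continuous_on_subset by blast
  then obtain s where s: "\<And>t. t \<in> {0..T} \<Longrightarrow> f t \<le> f s"
    using continuous_attains_sup[of "{0..T}" f] T by (metis atLeastAtMost_iff compact_Icc empty_iff less_imp_le order_refl)
  have "f t \<le> f s" for t
  proof -
    have "frac (t / T) \<ge> 0" "frac (t / T) \<le> 1" using frac_lt_1 less_imp_le by auto
    then have "T * frac (t / T) \<in> {0..T}" using T by (auto simp: mult_left_le)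
    from s[OF this] show ?thesis by (simp add: periodic_eq_frac[of T f, OF T per])
  qed
  then show thesis by (rule that)
qed

text \<open>Truncation is componentwise rather than radial: the sign of the k-th component of the
  truncated force is then controlled by the k-th coordinate alone, as the faces of a box and a
  maximum principle for single coordinates require.\<close>

definition trunc :: "real \<Rightarrow> real^'n \<Rightarrow> real^'n" where
  "trunc r z = (\<chi> k. max (- r) (min r (z $ k)))"

lemma trunc_nth: "trunc r z $ k = max (- r) (min r (z $ k))"
  by (simp add: trunc_def)

lemma trunc_id: "(\<And>k. \<bar>z $ k\<bar> \<le> r) \<Longrightarrow> trunc r z = z"
  unfolding vec_eq_iff trunc_nth by (metis abs_le_iff max.absorb2 min.absorb2 minus_le_iff)

lemma norm_trunc_diff_le: "norm (trunc r z - trunc r w) \<le> norm (z - w)"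
  by (rule norm_le_componentwise_cart) (auto simp: trunc_nth)

lemma norm_le_card_cart:
  fixes z :: "real^'n" and r :: real
  assumes "\<And>k. \<bar>z $ k\<bar> \<le> r"
  shows "norm z \<le> CARD('n) * r"
proof -
  have "norm z \<le> (\<Sum>k\<in>UNIV. \<bar>z $ k\<bar>)" by (rule norm_le_l1_cart)
  also have "\<dots> \<le> of_nat (card (UNIV :: 'n set)) * r" by (rule sum_bounded_above) (rule assms)
  finally show ?thesis by simp
qed

lemma norm_trunc_le: "(r::real) \<ge> 0 \<Longrightarrow> norm (trunc r z :: real^'n) \<le> real CARD('n) * r"
  by (rule norm_le_card_cart) (auto simp: trunc_nth)

lemma continuous_on_trunc [continuous_intros]:
  "continuous_on S u \<Longrightarrow> continuous_on S (\<lambda>x. trunc r (u x))"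
  unfolding trunc_def by (intro continuous_intros)

section \<open>Norm estimates for the factors of the chart\<close>

lemma norm_scaleR_diff_le: "norm (a *\<^sub>R x - b *\<^sub>R y) \<le> \<bar>a\<bar> * norm (x - y) + \<bar>a - b\<bar> * norm y"
proof -
  have "a *\<^sub>R x - b *\<^sub>R y = a *\<^sub>R (x - y) + (a - b) *\<^sub>R y" by (simp add: algebra_simps)
  then show ?thesis by (metis norm_scaleR norm_triangle_ineq)
qed

text \<open>The norm of the pair \<open>(1, z)\<close> is the square root of
  \<open>1 + |z|^2\<close>, the scale factor of the gnomonic chart. Written as a norm, it is
  Lipschitz in \<open>z\<close> by the triangle inequality.\<close>

lemma norm_1_Pair_ge: "norm (1::real, z::'a::real_normed_vector) \<ge> 1"
  using norm_fst_le[of "1::real" z] by simp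

lemma norm_1_Pair_pos: "norm (1::real, z::'a::real_normed_vector) > 0"
  using norm_1_Pair_ge[of z] by linarith

lemma norm_1_Pair_diff: "\<bar>norm (1::real, z::'a::real_normed_vector) - norm (1::real, w)\<bar> \<le> norm (z - w)"
  using norm_triangle_ineq3[of "(1::real, z)" "(1::real, w)"] by (simp add: norm_Pair)

section \<open>Bounds from derivatives and a maximum principle\<close>

lemma real_derivative_bound_Icc:
  fixes u u' :: "real \<Rightarrow> real"
  assumes "\<And>t. t \<in> {0..T} \<Longrightarrow> (u has_real_derivative u' t) (at t within {0..T})"
    and "\<And>t. t \<in> {0..T} \<Longrightarrow> \<bar>u' t\<bar> \<le> C" and "t \<in> {0..T}"
  shows "\<bar>u t - u 0\<bar> \<le> C * t"
  using field_differentiable_bound[of "{0..T}" u u' C t 0] assms by auto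

lemma real_derivative_nonneg_Icc:
  fixes u u' :: "real \<Rightarrow> real"
  assumes D: "\<And>t. t \<in> {0..T} \<Longrightarrow> (u has_real_derivative u' t) (at t within {0..T})"
    and "\<And>t. t \<in> {0..T} \<Longrightarrow> 0 \<le> u' t" and "T > 0"
  shows "u 0 \<le> u T"
proof (rule DERIV_nonneg_imp_increasing_open[where f = u])
  show "\<exists>y. DERIV u t :> y \<and> 0 \<le> y" if "0 < t" "t < T" for t
    using D[of t] assms(2)[of t] that at_within_Icc_at[of 0 t T] by auto
  show "continuous_on {0..T} u" using D DERIV_continuous_on by blast
qed (use assms in auto)

text \<open>At a maximum of \<open>y\<close> the momentum \<open>p\<close> vanishes, and \<open>p' > 0\<close> makes \<open>y\<close> increase further.\<close>

lemma periodic_max_principle: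
  fixes y p \<alpha> q :: "real \<Rightarrow> real"
  assumes T: "T > 0" and per: "\<And>t. y (t + T) = y t"
    and y': "\<And>t. (y has_real_derivative \<alpha> t * p t) (at t)" and \<alpha>: "\<And>t. \<alpha> t > 0"
    and p': "\<And>t. (p has_real_derivative q t) (at t)"
    and q: "\<And>t. y t > M \<Longrightarrow> q t > 0"
  shows "y t \<le> M"
proof -
  have "continuous_on UNIV y"
    using y' by (meson DERIV_isCont continuous_at_imp_continuous_on)
  then obtain s where s: "\<And>t. y t \<le> y s"
    using periodic_continuous_attains_sup[of T y, OF T per] by blast
  have "y s \<le> M"
  proof (rule ccontr)
    assume "\<not> y s \<le> M"
    then have "q s > 0" using q by simp
    moreover have "\<alpha> s * p s = 0"
      using DERIV_local_max[OF y'[of s], of 1] s by simp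
    then have "p s = 0" using \<alpha>[of s] by simp
    ultimately obtain d where d: "d > 0" "\<And>h. 0 < h \<Longrightarrow> h < d \<Longrightarrow> p (s + h) > 0"
      using DERIV_pos_inc_right[OF p'[of s]] by auto
    have "y s < y (s + d / 2)"
    proof (rule DERIV_pos_imp_increasing_open[where f = y])
      show "\<exists>D. DERIV y x :> D \<and> 0 < D" if "s < x" "x < s + d / 2" for x
        using y'[of x] \<alpha>[of x] d(2)[of "x - s"] that by auto
      show "continuous_on {s..s + d / 2} y" using \<open>continuous_on UNIV y\<close> continuous_on_subset by blast
    qed (use d in auto)
    then show False using s[of "s + d / 2"] by simp
  qed
  then show ?thesis using s[of t] by simp
qed

lemma has_real_derivative_vec_nth:
  assumes "(u has_vector_derivative u') F"
  shows "((\<lambda>t. u t $ k) has_real_derivative u' $ k) F"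
  using bounded_linear.has_vector_derivative[OF bounded_linear_vec_nth assms]
  by (simp add: has_real_derivative_iff_has_vector_derivative)

text \<open>Truncation keeps the scale factor between 1 and a constant \<open>R\<close> and bounds
  both vector factors, so each component of the field is a product of bounded Lipschitz functions of
  the state.\<close>

lemma lipschitz_scaled_field:
  fixes \<phi> :: "real \<Rightarrow> real^'n"
  assumes l: "l > 0" and g: "g > 0" and M: "M > 0" and Q: "Q > 0"
    and \<phi>: "\<And>t k. \<bar>\<phi> t $ k\<bar> \<le> g * M"
  obtains K where "K > 0" "\<And>t u v. norm
      (((norm (1::real, trunc M (fst u)) / l)\<^sup>2 *\<^sub>R trunc Q (snd u),
        (l / norm (1::real, trunc M (fst u))) *\<^sub>R (g *\<^sub>R trunc M (fst u) - \<phi> t))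
     - ((norm (1::real, trunc M (fst v)) / l)\<^sup>2 *\<^sub>R trunc Q (snd v),
        (l / norm (1::real, trunc M (fst v))) *\<^sub>R (g *\<^sub>R trunc M (fst v) - \<phi> t)))
     \<le> K * norm (u - v :: (real^'n) \<times> (real^'n))"
proof -
  define c where "c = real CARD('n)"
  define n where "n z = norm (1::real, trunc M z)" for z :: "real^'n"
  define R where "R = 1 + c * M"
  have c: "c > 0" by (simp add: c_def)
  have n1: "n z \<ge> 1" for z unfolding n_def by (rule norm_1_Pair_ge)
  have nR: "n z \<le> R" for z
    using norm_Pair_le[of "1::real" "trunc M z"] norm_trunc_le[of M z] M by (simp add: n_def R_def c_def)
  have nd: "\<bar>n z - n w\<bar> \<le> norm (z - w)" for z w
    unfolding n_def by (rule order_trans[OF norm_1_Pair_diff norm_trunc_diff_le])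
  \<comment> \<open>Each constant is (bound of the scalar) times (Lipschitz constant of the vector)
    plus (Lipschitz constant of the scalar) times (bound of the vector). The scalar in
    \<open>K1\<close> is a square, whence \<open>2 * R\<close>; the one in \<open>K2\<close> is a
    reciprocal, tamed by \<open>n z \<ge> 1\<close>.\<close>
  define K1 where "K1 = (R / l)\<^sup>2 + 2 * R / l\<^sup>2 * (c * Q)"
  define K2 where "K2 = l * g + l * (c * (2 * g * M))"
  have est1: "norm ((n y / l)\<^sup>2 *\<^sub>R trunc Q p - (n z / l)\<^sup>2 *\<^sub>R trunc Q q)
      \<le> K1 * norm ((y, p) - (z, q))" for y z and p q :: "real^'n"
  proof -
    have y: "norm (y - z) \<le> norm ((y, p) - (z, q))" and p: "norm (p - q) \<le> norm ((y, p) - (z, q))"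
      using norm_fst_le[of "y - z" "p - q"] norm_snd_le[of "p - q" "y - z"] by auto
    have "\<bar>(n y / l)\<^sup>2\<bar> * norm (trunc Q p - trunc Q q) \<le> (R / l)\<^sup>2 * norm ((y, p) - (z, q))"
      using n1[of y] nR[of y] l by (intro mult_mono order_trans[OF norm_trunc_diff_le p])
        (auto intro!: power_mono divide_right_mono)
    moreover have "\<bar>(n y / l)\<^sup>2 - (n z / l)\<^sup>2\<bar> * norm (trunc Q q)
        \<le> (2 * R / l\<^sup>2 * norm ((y, p) - (z, q))) * (c * Q)"
    proof (intro mult_mono)
      have "\<bar>(n y / l)\<^sup>2 - (n z / l)\<^sup>2\<bar> = (n y + n z) / l\<^sup>2 * \<bar>n y - n z\<bar>"
        using n1[of y] n1[of z] l
        by (simp add: power_divide diff_divide_distrib[symmetric] abs_mult square_diff_square_factored power2_eq_square)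
      also have "\<dots> \<le> 2 * R / l\<^sup>2 * norm ((y, p) - (z, q))"
        using n1[of y] n1[of z] nR[of y] nR[of z] l order_trans[OF nd y]
        by (intro mult_mono divide_right_mono) auto
      finally show "\<bar>(n y / l)\<^sup>2 - (n z / l)\<^sup>2\<bar> \<le> 2 * R / l\<^sup>2 * norm ((y, p) - (z, q))" .
      show "norm (trunc Q q) \<le> c * Q" unfolding c_def using Q by (intro norm_trunc_le) simp
    qed (use n1[of y] nR[of y] l in auto)
    ultimately show ?thesis
      using norm_scaleR_diff_le[of "(n y / l)\<^sup>2" "trunc Q p" "(n z / l)\<^sup>2" "trunc Q q"]
      unfolding K1_def distrib_right by (simp add: mult_ac)
  qed
  have est2: "norm ((l / n y) *\<^sub>R (g *\<^sub>R trunc M y - \<phi> t) - (l / n z) *\<^sub>R (g *\<^sub>R trunc M z - \<phi> t))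
      \<le> K2 * norm (y - z)" for y z t
  proof -
    have "\<bar>l / n y\<bar> * norm ((g *\<^sub>R trunc M y - \<phi> t) - (g *\<^sub>R trunc M z - \<phi> t)) \<le> l * (g * norm (y - z))"
    proof (intro mult_mono)
      show "\<bar>l / n y\<bar> \<le> l" using n1[of y] l by (simp add: abs_of_pos pos_divide_le_eq)
      show "norm ((g *\<^sub>R trunc M y - \<phi> t) - (g *\<^sub>R trunc M z - \<phi> t)) \<le> g * norm (y - z)"
        using norm_trunc_diff_le[of M y z] g by (simp flip: scaleR_diff_right)
    qed (use l in auto)
    moreover have "\<bar>l / n y - l / n z\<bar> * norm (g *\<^sub>R trunc M z - \<phi> t) \<le> (l * norm (y - z)) * (c * (2 * g * M))"
    proof (intro mult_mono)
      have "\<bar>l / n y - l / n z\<bar> = l * \<bar>n y - n z\<bar> / (n y * n z)"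
        using n1[of y] n1[of z] l
        by (simp add: diff_frac_eq abs_mult abs_minus_commute flip: right_diff_distrib)
      also have "\<dots> \<le> l * \<bar>n y - n z\<bar>"
        using mult_mono[OF n1[of y] n1[of z]] n1[of y] l divide_left_mono[of 1 "n y * n z" "l * \<bar>n y - n z\<bar>"]
        by simp
      also have "\<dots> \<le> l * norm (y - z)" using nd l by (intro mult_left_mono) auto
      finally show "\<bar>l / n y - l / n z\<bar> \<le> l * norm (y - z)" .
      show "norm (g *\<^sub>R trunc M z - \<phi> t) \<le> c * (2 * g * M)"
        unfolding c_def
      proof (rule norm_le_card_cart)
        fix k
        have "\<bar>g * trunc M z $ k\<bar> \<le> g * M"
          unfolding abs_mult using g M by (intro mult_mono) (auto simp: trunc_nth)
        then show "\<bar>(g *\<^sub>R trunc M z - \<phi> t) $ k\<bar> \<le> 2 * g * M"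
          using \<phi>[of t k] by auto
      qed
    qed (use l in auto)
    ultimately show ?thesis
      using norm_scaleR_diff_le[of "l / n y" "g *\<^sub>R trunc M y - \<phi> t" "l / n z" "g *\<^sub>R trunc M z - \<phi> t"]
      unfolding K2_def distrib_right by (simp add: mult_ac)
  qed
  show thesis
  proof
    show "K1 + K2 > 0" using l g M Q c by (auto simp: K1_def K2_def R_def intro!: add_pos_pos add_nonneg_pos)
    fix t and u v :: "(real^'n) \<times> (real^'n)"
    obtain y p z q where [simp]: "u = (y, p)" "v = (z, q)" by (metis surj_pair)
    have K2: "K2 \<ge> 0" using l g M c by (auto simp: K2_def)
    have "norm ((n y / l)\<^sup>2 *\<^sub>R trunc Q p - (n z / l)\<^sup>2 *\<^sub>R trunc Q q,
        (l / n y) *\<^sub>R (g *\<^sub>R trunc M y - \<phi> t) - (l / n z) *\<^sub>R (g *\<^sub>R trunc M z - \<phi> t))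
      \<le> K1 * norm (u - v) + K2 * norm (u - v)"
    proof (intro order_trans[OF norm_Pair_le add_mono])
      show "norm ((n y / l)\<^sup>2 *\<^sub>R trunc Q p - (n z / l)\<^sup>2 *\<^sub>R trunc Q q) \<le> K1 * norm (u - v)"
        using est1[of y p z q] by simp
      have "norm (y - z) \<le> norm (u - v)" using norm_fst_le[of "y - z" "p - q"] by simp
      then show "norm ((l / n y) *\<^sub>R (g *\<^sub>R trunc M y - \<phi> t) - (l / n z) *\<^sub>R (g *\<^sub>R trunc M z - \<phi> t))
          \<le> K2 * norm (u - v)"
        by (rule order_trans[OF est2 mult_left_mono[OF _ K2]])
    qed
    then show "norm
      (((norm (1::real, trunc M (fst u)) / l)\<^sup>2 *\<^sub>R trunc Q (snd u),
        (l / norm (1::real, trunc M (fst u))) *\<^sub>R (g *\<^sub>R trunc M (fst u) - \<phi> t))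
     - ((norm (1::real, trunc M (fst v)) / l)\<^sup>2 *\<^sub>R trunc Q (snd v),
        (l / norm (1::real, trunc M (fst v))) *\<^sub>R (g *\<^sub>R trunc M (fst v) - \<phi> t)))
     \<le> (K1 + K2) * norm (u - v)"
      by (simp add: n_def distrib_right)
  qed
qed

subsection \<open>The pendulum in the gnomonic chart\<close>

text \<open>The two truncations are removed by different arguments: the one of \<open>p\<close> at
  level \<open>Q\<close> because \<open>p\<close> cannot drift that far from the box in time
  \<open>T\<close>, the one of \<open>y\<close> at level \<open>M\<close> by the maximum
  principle.\<close>

lemma gnomonic_periodic_solution:
  fixes \<phi> :: "real \<Rightarrow> real^'n"
  assumes l: "l > 0" and g: "g > 0" and T: "T > 0"
    and cont: "continuous_on UNIV \<phi>" and per: "\<And>t. \<phi> (t + T) = \<phi> t"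
  obtains y p where
    "\<And>t. (y has_vector_derivative (norm (1::real, y t) / l)\<^sup>2 *\<^sub>R p t) (at t)"
    "\<And>t. (p has_vector_derivative (l / norm (1::real, y t)) *\<^sub>R (g *\<^sub>R y t - \<phi> t)) (at t)"
    "\<And>t. y (t + T) = y t"
proof -
  have "continuous_on UNIV (\<lambda>t. norm (\<phi> t))" by (intro continuous_intros cont)
  then obtain s where s: "\<And>t. norm (\<phi> t) \<le> norm (\<phi> s)"
    using periodic_continuous_attains_sup[of T "\<lambda>t. norm (\<phi> t)"] T per by auto
  \<comment> \<open>The summand 1 makes \<open>g * M\<close> strictly larger than every component of
    the forcing, so that the force has a strict sign already at \<open>y_k = M\<close> and
    \<open>y_k = - M\<close>.\<close>
  define M where "M = (norm (\<phi> s) + 1) / g"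
  have M: "M > 0" using g by (simp add: M_def add_nonneg_pos)
  have \<phi>M: "\<bar>\<phi> t $ k\<bar> < g * M" for t k
    using component_le_norm_cart[of "\<phi> t" k] s[of t] g by (simp add: M_def)
  define c where "c = real CARD('n)"
  define n where "n z = norm (1::real, trunc M z)" for z :: "real^'n"
  define R where "R = 1 + c * M"
  have n1: "n z \<ge> 1" for z unfolding n_def by (rule norm_1_Pair_ge)
  have nR: "n z \<le> R" for z
    using norm_Pair_le[of "1::real" "trunc M z"] norm_trunc_le[of M z] M by (simp add: n_def R_def c_def)
  \<comment> \<open>\<open>C\<close> bounds each component of the force, so \<open>p\<close> drifts
    by at most \<open>C * T\<close>. The box allows initial momenta up to \<open>C * T\<close>;
    hence a component starting on a face keeps its sign, and \<open>Q = 2 * C * T\<close> is never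
    exceeded.\<close>
  define C where "C = 2 * l * g * M"
  define Q where "Q = 2 * C * T"
  have C: "C > 0" and Q: "Q > 0" using l g M T by (auto simp: C_def Q_def)
  \<comment> \<open>\<open>L\<close> bounds the speed of each component of \<open>y\<close>. With
    the margin \<open>L * T\<close> beyond \<open>M\<close>, a component starting at
    \<open>B\<close> or \<open>- B\<close> stays where the force has a definite sign during the
    whole period.\<close>
  define L where "L = (R / l)\<^sup>2 * Q"
  define B where "B = M + L * T"
  have L: "L \<ge> 0" using Q by (simp add: L_def)
  define F1 where "F1 u = (n (fst u) / l)\<^sup>2 *\<^sub>R trunc Q (snd u)" for u :: "(real^'n) \<times> (real^'n)"
  define F2 where "F2 t u = (l / n (fst u)) *\<^sub>R (g *\<^sub>R trunc M (fst u) - \<phi> t)" for t and u :: "(real^'n) \<times> (real^'n)"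
  have F1L: "\<bar>F1 u $ k\<bar> \<le> L" for u k
  proof -
    have "(n (fst u) / l)\<^sup>2 * \<bar>trunc Q (snd u) $ k\<bar> \<le> L"
      unfolding L_def using n1[of "fst u"] nR[of "fst u"] l Q
      by (intro mult_mono power_mono divide_right_mono) (auto simp: trunc_nth)
    then show ?thesis by (simp add: F1_def abs_mult)
  qed
  have F2C: "\<bar>F2 t u $ k\<bar> \<le> C" for t u k
  proof -
    have "\<bar>g * trunc M (fst u) $ k\<bar> \<le> g * M"
      unfolding abs_mult using g M by (intro mult_mono) (auto simp: trunc_nth)
    then have "\<bar>(g *\<^sub>R trunc M (fst u) - \<phi> t) $ k\<bar> \<le> 2 * g * M"
      using \<phi>M[of t k] by auto
    then have "l / n (fst u) * \<bar>(g *\<^sub>R trunc M (fst u) - \<phi> t) $ k\<bar> \<le> l * (2 * g * M)"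
      using n1[of "fst u"] l by (intro mult_mono) (auto simp: pos_divide_le_eq)
    then show ?thesis using n1[of "fst u"] l by (simp add: F2_def C_def abs_mult mult_ac)
  qed
  have F2_pos: "F2 t u $ k > 0" if "fst u $ k \<ge> M" for t u k
    using that \<phi>M[of t k] n1[of "fst u"] l M by (simp add: F2_def trunc_nth)
  have F2_neg: "F2 t u $ k < 0" if "fst u $ k \<le> - M" for t u k
    using that \<phi>M[of t k] n1[of "fst u"] l M by (auto simp: F2_def trunc_nth intro!: divide_neg_pos mult_pos_neg)
  have contF: "continuous_on UNIV (\<lambda>(t, u). (F1 u, F2 t u))"
    unfolding case_prod_beta F1_def F2_def n_def
    using norm_1_Pair_pos l
    by (intro continuous_intros continuous_on_compose2[OF cont]) (auto simp: less_imp_neq[symmetric])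
  obtain K where K: "K > 0" "\<And>t u v. norm ((F1 u, F2 t u) - (F1 v, F2 t v)) \<le> K * norm (u - v)"
    by (rule lipschitz_scaled_field[where \<phi> = \<phi>, OF l g M Q less_imp_le[OF \<phi>M],
          folded n_def, folded F1_def F2_def]) (rule that)
  obtain \<Phi> where \<Phi>0: "\<And>c. \<Phi> c 0 = c"
    and \<Phi>D: "\<And>c t. t \<in> {0..T} \<Longrightarrow> (\<Phi> c has_vector_derivative (F1 (\<Phi> c t), F2 t (\<Phi> c t))) (at t within {0..T})"
    and \<Phi>c: "continuous_on UNIV (\<lambda>c. \<Phi> c T)"
    by (rule lipschitz_ode_flow[where F = "\<lambda>t u. (F1 u, F2 t u)", OF contF K(2) K(1) T]) (rule that)
  have D1: "((\<lambda>t. fst (\<Phi> c t) $ k) has_real_derivative F1 (\<Phi> c t) $ k) (at t within {0..T})"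
    and D2: "((\<lambda>t. snd (\<Phi> c t) $ k) has_real_derivative F2 t (\<Phi> c t) $ k) (at t within {0..T})"
    if "t \<in> {0..T}" for c t k
    using has_real_derivative_vec_nth[OF bounded_linear.has_vector_derivative[OF bounded_linear_fst \<Phi>D[OF that]]]
      has_real_derivative_vec_nth[OF bounded_linear.has_vector_derivative[OF bounded_linear_snd \<Phi>D[OF that]]]
    by auto
  have E1: "\<bar>fst (\<Phi> c t) $ k - fst c $ k\<bar> \<le> L * T"
    and E2: "\<bar>snd (\<Phi> c t) $ k - snd c $ k\<bar> \<le> C * T" if t: "t \<in> {0..T}" for c t k
  proof -
    have "\<bar>fst (\<Phi> c t) $ k - fst (\<Phi> c 0) $ k\<bar> \<le> L * t"
      by (rule real_derivative_bound_Icc[OF D1]) (use F1L t in auto)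
    also have "\<dots> \<le> L * T" using t L by (intro mult_left_mono) auto
    finally show "\<bar>fst (\<Phi> c t) $ k - fst c $ k\<bar> \<le> L * T" by (simp add: \<Phi>0)
    have "\<bar>snd (\<Phi> c t) $ k - snd (\<Phi> c 0) $ k\<bar> \<le> C * t"
      by (rule real_derivative_bound_Icc[OF D2]) (use F2C t in auto)
    also have "\<dots> \<le> C * T" using t C by (intro mult_left_mono) auto
    finally show "\<bar>snd (\<Phi> c t) $ k - snd c $ k\<bar> \<le> C * T" by (simp add: \<Phi>0)
  qed
  let ?b = "((\<chi> k. B), (\<chi> k. C * T)) :: (real^'n) \<times> (real^'n)"
  have inb: "\<bar>snd c $ k\<bar> \<le> C * T" if "c \<in> cbox (- ?b) ?b" for c k
    using that by (cases c) (auto simp: uminus_prod_def cbox_Pair_eq mem_box_cart abs_le_iff minus_le_iff)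
  have B: "B > 0" using M L T by (simp add: B_def add_pos_nonneg)
  have CT: "C * T > 0" using C T by simp
  \<comment> \<open>The components are swapped: on the faces of \<open>y\<close> it is the
    displacement of \<open>p\<close> whose sign is known, and on the faces of \<open>p\<close> that
    of \<open>y\<close>.\<close>
  define G where "G c = (snd (\<Phi> c T) - snd c, fst (\<Phi> c T) - fst c)" for c
  have basis: "\<exists>k. i = (axis k 1, 0) \<or> i = (0, axis k 1)" if "i \<in> Basis" for i :: "(real^'n) \<times> (real^'n)"
    using that by (auto simp: Basis_prod_def Basis_vec_def)
  have F1_sgn: "snd u $ k \<ge> 0 \<Longrightarrow> F1 u $ k \<ge> 0" "snd u $ k \<le> 0 \<Longrightarrow> F1 u $ k \<le> 0" for u k
    using Q by (auto simp: F1_def trunc_nth intro!: mult_nonneg_nonpos)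
  have mono_pos: "fst (\<Phi> c T) $ k \<ge> fst c $ k" if "snd c $ k = C * T" for c k
  proof -
    have "fst (\<Phi> c 0) $ k \<le> fst (\<Phi> c T) $ k"
    proof (rule real_derivative_nonneg_Icc[OF D1 _ T])
      fix t assume t: "t \<in> {0..T}"
      show "0 \<le> F1 (\<Phi> c t) $ k" using E2[OF t, of c k] that by (intro F1_sgn) auto
    qed
    then show ?thesis by (simp add: \<Phi>0)
  qed
  have mono_neg: "fst (\<Phi> c T) $ k \<le> fst c $ k" if "snd c $ k = - (C * T)" for c k
  proof -
    have "- fst (\<Phi> c 0) $ k \<le> - fst (\<Phi> c T) $ k"
    proof (rule real_derivative_nonneg_Icc[OF DERIV_minus[OF D1] _ T])
      fix t assume t: "t \<in> {0..T}"
      have "F1 (\<Phi> c t) $ k \<le> 0" using E2[OF t, of c k] that by (intro F1_sgn) auto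
      then show "0 \<le> - F1 (\<Phi> c t) $ k" by simp
    qed
    then show ?thesis by (simp add: \<Phi>0)
  qed
  have grow_pos: "snd (\<Phi> c T) $ k \<ge> snd c $ k" if "fst c $ k = B" for c k
  proof -
    have "snd (\<Phi> c 0) $ k \<le> snd (\<Phi> c T) $ k"
    proof (rule real_derivative_nonneg_Icc[OF D2 _ T])
      fix t assume t: "t \<in> {0..T}"
      show "0 \<le> F2 t (\<Phi> c t) $ k"
        using E1[OF t, of c k] that by (intro less_imp_le[OF F2_pos]) (auto simp: B_def)
    qed
    then show ?thesis by (simp add: \<Phi>0)
  qed
  have grow_neg: "snd (\<Phi> c T) $ k \<le> snd c $ k" if "fst c $ k = - B" for c k
  proof -
    have "- snd (\<Phi> c 0) $ k \<le> - snd (\<Phi> c T) $ k"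
    proof (rule real_derivative_nonneg_Icc[OF DERIV_minus[OF D2] _ T])
      fix t assume t: "t \<in> {0..T}"
      have "F2 t (\<Phi> c t) $ k < 0"
        using E1[OF t, of c k] that by (intro F2_neg) (auto simp: B_def)
      then show "0 \<le> - F2 t (\<Phi> c t) $ k" by simp
    qed
    then show ?thesis by (simp add: \<Phi>0)
  qed
  obtain c where cb: "c \<in> cbox (- ?b) ?b" and Gc: "G c = 0"
  proof (rule poincare_miranda[of "- ?b" ?b G])
    show "- ?b \<bullet> i \<le> ?b \<bullet> i" if "i \<in> Basis" for i
      using basis[OF that] B CT by (auto simp: inner_axis)
    show "continuous_on (cbox (- ?b) ?b) G"
      unfolding G_def by (intro continuous_intros continuous_on_subset[OF \<Phi>c]) auto
    show "G x \<bullet> i \<le> 0" if "x \<in> cbox (- ?b) ?b" "i \<in> Basis" "x \<bullet> i = - ?b \<bullet> i" for x i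
      using basis[OF that(2)] that(3) mono_neg[of x] grow_neg[of x]
      by (cases x) (auto simp: inner_axis G_def)
    show "G x \<bullet> i \<ge> 0" if "x \<in> cbox (- ?b) ?b" "i \<in> Basis" "x \<bullet> i = ?b \<bullet> i" for x i
      using basis[OF that(2)] that(3) mono_pos[of x] grow_pos[of x]
      by (cases x) (auto simp: inner_axis G_def)
  qed
  have \<Phi>T: "\<Phi> c T = \<Phi> c 0"
    using Gc by (simp add: G_def \<Phi>0 prod_eq_iff)
  define u where "u t = \<Phi> c (T * frac (t / T))" for t
  have frac: "T * frac (t / T) \<in> {0..T}" for t
    using T frac_ge_0[of "t / T"] frac_lt_1[of "t / T"] by (auto simp: mult_left_le)
  have uD: "(u has_vector_derivative (F1 (u t), F2 t (u t))) (at t)" for t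
  proof -
    \<comment> \<open>The field depends on time through the forcing, so the slopes at both ends of
      the period agree only because the forcing is periodic too.\<close>
    have "\<phi> T = \<phi> 0" using per[of 0] by simp
    then have "(u has_vector_derivative
        (F1 (\<Phi> c (T * frac (t / T))), F2 (T * frac (t / T)) (\<Phi> c (T * frac (t / T))))) (at t)"
      unfolding u_def[abs_def]
      by (intro periodic_extension_has_vector_derivative[where w = "\<lambda>t. (F1 (\<Phi> c t), F2 t (\<Phi> c t))"] T \<Phi>D)
        (auto simp: \<Phi>T F2_def)
    then show ?thesis using periodic_eq_frac[of T \<phi>, OF T per] by (simp add: u_def F2_def)
  qed
  have uT: "u (t + T) = u t" for t
    using T by (simp add: u_def add_divide_distrib frac_1_eq)
  have DY: "((\<lambda>t. fst (u t) $ k) has_real_derivative F1 (u t) $ k) (at t)"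
    and DP: "((\<lambda>t. snd (u t) $ k) has_real_derivative F2 t (u t) $ k) (at t)" for t k
    using has_real_derivative_vec_nth[OF bounded_linear.has_vector_derivative[OF bounded_linear_fst uD]]
      has_real_derivative_vec_nth[OF bounded_linear.has_vector_derivative[OF bounded_linear_snd uD]]
    by auto
  \<comment> \<open>At most \<open>C * T\<close> from the initial value in the box and at most
    \<open>C * T\<close> from the drift.\<close>
  have "\<bar>snd (u t) $ k\<bar> \<le> Q" for t k
    using E2[OF frac, of c t k] inb[OF cb, of k] unfolding u_def Q_def by linarith
  then have trQ: "trunc Q (snd (u t)) = snd (u t)" for t by (rule trunc_id)
  have F1u: "F1 (u t) = (n (fst (u t)) / l)\<^sup>2 *\<^sub>R snd (u t)" for t
    by (simp add: F1_def trQ)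
  have npos: "(n z / l)\<^sup>2 > 0" for z
    using n1[of z] l by simp
  \<comment> \<open>The truncation of \<open>p\<close> had to go first: only now is the derivative
    of \<open>y_k\<close> a positive multiple of \<open>p_k\<close> itself.\<close>
  have "fst (u t) $ k \<le> M" for t k
    by (rule periodic_max_principle[of T "\<lambda>t. fst (u t) $ k" "\<lambda>t. (n (fst (u t)) / l)\<^sup>2"
            "\<lambda>t. snd (u t) $ k" "\<lambda>t. F2 t (u t) $ k"])
      (use T uT DY DP npos F2_pos in \<open>auto simp: F1u\<close>)
  moreover have "- fst (u t) $ k \<le> M" for t k
  proof (rule periodic_max_principle[of T "\<lambda>t. - fst (u t) $ k" "\<lambda>t. (n (fst (u t)) / l)\<^sup>2"
            "\<lambda>t. - snd (u t) $ k" "\<lambda>t. - F2 t (u t) $ k"])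
    show "((\<lambda>t. - fst (u t) $ k) has_real_derivative (n (fst (u t)) / l)\<^sup>2 * - snd (u t) $ k) (at t)" for t
      using DERIV_minus[OF DY[of k t]] by (simp add: F1u)
    show "((\<lambda>t. - snd (u t) $ k) has_real_derivative - F2 t (u t) $ k) (at t)" for t
      by (rule DERIV_minus[OF DP])
    show "0 < - F2 t (u t) $ k" if "M < - fst (u t) $ k" for t
      using F2_neg[of "u t" k t] that by simp
  qed (use T uT npos in auto)
  ultimately have trM: "trunc M (fst (u t)) = fst (u t)" for t
    by (intro trunc_id) (simp add: abs_le_iff)
  show thesis
  proof
    show "((\<lambda>t. fst (u t)) has_vector_derivative (norm (1::real, fst (u t)) / l)\<^sup>2 *\<^sub>R snd (u t)) (at t)" for t
      using bounded_linear.has_vector_derivative[OF bounded_linear_fst uD[of t]]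
      by (simp add: F1u n_def trM)
    show "((\<lambda>t. snd (u t)) has_vector_derivative (l / norm (1::real, fst (u t))) *\<^sub>R (g *\<^sub>R fst (u t) - \<phi> t)) (at t)" for t
      using bounded_linear.has_vector_derivative[OF bounded_linear_snd uD[of t]]
      by (simp add: F2_def n_def trM)
    show "fst (u (t + T)) = fst (u t)" for t by (simp add: uT)
  qed
qed

subsection \<open>Back to the position of the rod\<close>

lemma periodic_derivative:
  assumes "\<And>t. u (t + T) = u t" and D: "\<And>t. (u has_vector_derivative v t) (at t)"
  shows "v (t + T) = v t"
proof -
  have "((u \<circ> (\<lambda>s. s + T)) has_vector_derivative 1 *\<^sub>R v (t + T)) (at t)"
    by (rule vector_diff_chain_at) (auto intro!: derivative_eq_intros D)
  then have "(u has_vector_derivative v (t + T)) (at t)"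
    using assms(1) by (simp add: o_def)
  then show ?thesis using vector_derivative_unique_at[OF _ D] by simp
qed

text \<open>The components of \<open>p\<close> are angular momenta: passing back from the chart \<open>y = x / h\<close>,
  \<open>p = h x' - h' x\<close> for the height \<open>h\<close>, and the acceleration follows from \<open>p' = g x - h \<phi>\<close>.\<close>

lemma pendulum_equation_of_gnomonic:
  fixes y p \<phi> :: "real \<Rightarrow> real^'n"
  assumes l: "l > 0"
    and y': "\<And>t. (y has_vector_derivative (norm (1::real, y t) / l)\<^sup>2 *\<^sub>R p t) (at t)"
    and p': "\<And>t. (p has_vector_derivative (l / norm (1::real, y t)) *\<^sub>R (g *\<^sub>R y t - \<phi> t)) (at t)"
  defines "x \<equiv> \<lambda>t. (l / norm (1::real, y t)) *\<^sub>R y t"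
  obtains x1 where "\<And>t. norm (x t) < l"
    "\<And>t. (x has_vector_derivative x1 t) (at t)"
    "\<And>t. (x1 has_vector_derivative
        ((1 / l\<^sup>2) * (g * sqrt (l\<^sup>2 - (norm (x t))\<^sup>2)
                       - (x t \<bullet> x1 t)\<^sup>2 / (l\<^sup>2 - (norm (x t))\<^sup>2)
                       - (norm (x1 t))\<^sup>2)) *\<^sub>R x t
        + ((x t \<bullet> \<phi> t) / l\<^sup>2) *\<^sub>R x t - \<phi> t) (at t)"
proof -
  define h where "h t = l / norm (1::real, y t)" for t
  define s where "s t = x t \<bullet> p t" for t
  \<comment> \<open>This is the product rule for \<open>x = h y\<close> with
    \<open>y' = p / h^2\<close> and \<open>h' = - s / l^2\<close>, rewritten with
    \<open>y = x / h\<close>.\<close>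
  define x1 where "x1 t = (1 / h t) *\<^sub>R (p t - (s t / l\<^sup>2) *\<^sub>R x t)" for t
  have hpos: "h t > 0" for t using l norm_1_Pair_pos[of "y t"] by (simp add: h_def)
  have xh: "x t = h t *\<^sub>R y t" for t by (simp add: x_def h_def)
  have nh: "norm (1::real, y t) / l = 1 / h t" for t by (simp add: h_def)
  have hsqrt: "h t = l / sqrt (1 + y t \<bullet> y t)" for t
    by (simp add: h_def norm_Pair power2_norm_eq_inner)
  have q: "1 + y t \<bullet> y t > 0" for t by (simp add: add_pos_nonneg)
  have sq: "sqrt (1 + y t \<bullet> y t) = l / h t" for t using l hpos[of t] by (simp add: hsqrt)
  \<comment> \<open>This identifies \<open>h\<close> as the height of the top of the rod; positivity
    of \<open>h\<close> later gives \<open>norm (x t) < l\<close>.\<close>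
  have hx: "(h t)\<^sup>2 = l\<^sup>2 - x t \<bullet> x t" for t
  proof -
    have "(h t)\<^sup>2 * (1 + y t \<bullet> y t) = l\<^sup>2"
      using q[of t] by (simp add: hsqrt power_divide)
    then show ?thesis by (simp add: xh algebra_simps power2_eq_square)
  qed
  have yD: "(y has_vector_derivative (1 / (h t)\<^sup>2) *\<^sub>R p t) (at t)" for t
    using y'[of t] by (simp add: nh power_divide)
  have pD: "(p has_vector_derivative g *\<^sub>R x t - h t *\<^sub>R \<phi> t) (at t)" for t
    using p'[of t] by (simp add: xh h_def scaleR_diff_right mult_ac)
  have hD: "(h has_real_derivative - (s t / l\<^sup>2)) (at t)" for t
  proof -
    have "((\<lambda>t. y t \<bullet> y t) has_real_derivative 2 * (y t \<bullet> p t) / (h t)\<^sup>2) (at t)"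
      using bounded_bilinear.has_vector_derivative[OF bounded_bilinear_inner yD yD, of t]
      by (simp add: has_real_derivative_iff_has_vector_derivative inner_commute)
    from DERIV_add[OF DERIV_const this, of 1]
    have "((\<lambda>t. 1 + y t \<bullet> y t) has_real_derivative 2 * (y t \<bullet> p t) / (h t)\<^sup>2) (at t)" by simp
    from DERIV_chain2[OF DERIV_real_sqrt[OF q] this]
    have "((\<lambda>t. sqrt (1 + y t \<bullet> y t)) has_real_derivative
        inverse (l / h t) / 2 * (2 * (y t \<bullet> p t) / (h t)\<^sup>2)) (at t)"
      unfolding sq .
    from DERIV_divide[OF DERIV_const[of l] this]
    have "((\<lambda>t. l / sqrt (1 + y t \<bullet> y t)) has_real_derivative
        (0 * (l / h t) - l * (inverse (l / h t) / 2 * (2 * (y t \<bullet> p t) / (h t)\<^sup>2)))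
          / ((l / h t) * (l / h t))) (at t)"
      unfolding sq using l hpos[of t] by simp
    moreover have "(0 * (l / h t) - l * (inverse (l / h t) / 2 * (2 * (y t \<bullet> p t) / (h t)\<^sup>2)))
          / ((l / h t) * (l / h t)) = - (s t / l\<^sup>2)"
      using l hpos[of t] by (simp add: s_def xh field_simps power2_eq_square)
    ultimately show ?thesis unfolding hsqrt[abs_def] by simp
  qed
  have yx: "y t = (1 / h t) *\<^sub>R x t" for t using hpos[of t] by (simp add: xh)
  have xD: "(x has_vector_derivative x1 t) (at t)" for t
  proof -
    have "((\<lambda>t. h t *\<^sub>R y t) has_vector_derivative
        h t *\<^sub>R ((1 / (h t)\<^sup>2) *\<^sub>R p t) + (- (s t / l\<^sup>2)) *\<^sub>R y t) (at t)"
      by (rule has_vector_derivative_scaleR[OF hD yD])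
    moreover have "h t *\<^sub>R ((1 / (h t)\<^sup>2) *\<^sub>R p t) + (- (s t / l\<^sup>2)) *\<^sub>R y t = x1 t"
      using hpos[of t] unfolding yx x1_def by (simp add: scaleR_diff_right power2_eq_square mult_ac)
    ultimately show ?thesis by (simp add: xh[abs_def])
  qed
  define s1 where "s1 t = x t \<bullet> (g *\<^sub>R x t - h t *\<^sub>R \<phi> t) + x1 t \<bullet> p t" for t
  have sD: "(s has_real_derivative s1 t) (at t)" for t
    unfolding has_real_derivative_iff_has_vector_derivative s_def[abs_def] s1_def
    by (rule bounded_bilinear.has_vector_derivative[OF bounded_bilinear_inner xD pD])
  have ihD: "((\<lambda>t. 1 / h t) has_real_derivative s t / (l\<^sup>2 * (h t)\<^sup>2)) (at t)" for t
    using DERIV_inverse_fun[OF hD[of t]] hpos[of t]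
    by (simp add: divide_inverse power2_eq_square mult_ac)
  have x1D: "(x1 has_vector_derivative (1 / h t) *\<^sub>R (g *\<^sub>R x t - h t *\<^sub>R \<phi> t - (s1 t / l\<^sup>2) *\<^sub>R x t)) (at t)" for t
  proof -
    have "((\<lambda>t. (1 / h t) *\<^sub>R (p t - (s t / l\<^sup>2) *\<^sub>R x t)) has_vector_derivative
        (1 / h t) *\<^sub>R (g *\<^sub>R x t - h t *\<^sub>R \<phi> t - ((s t / l\<^sup>2) *\<^sub>R x1 t + (s1 t / l\<^sup>2) *\<^sub>R x t))
        + (s t / (l\<^sup>2 * (h t)\<^sup>2)) *\<^sub>R (p t - (s t / l\<^sup>2) *\<^sub>R x t)) (at t)"
      by (intro has_vector_derivative_scaleR ihD has_vector_derivative_diff pD DERIV_cdivide sD xD)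
    then have "(x1 has_vector_derivative
        (1 / h t) *\<^sub>R (g *\<^sub>R x t - h t *\<^sub>R \<phi> t - ((s t / l\<^sup>2) *\<^sub>R x1 t + (s1 t / l\<^sup>2) *\<^sub>R x t))
        + (s t / (l\<^sup>2 * (h t)\<^sup>2)) *\<^sub>R (p t - (s t / l\<^sup>2) *\<^sub>R x t)) (at t)"
      by (simp only: x1_def[abs_def, symmetric])
    \<comment> \<open>The term from differentiating \<open>1 / h\<close> is again a multiple of
      \<open>x1\<close> and cancels the term with \<open>s * x1\<close> from the product rule, so
      only the one with \<open>s1\<close> remains.\<close>
    moreover have "(s t / (l\<^sup>2 * (h t)\<^sup>2)) *\<^sub>R (p t - (s t / l\<^sup>2) *\<^sub>R x t)
        = (1 / h t) *\<^sub>R (s t / l\<^sup>2) *\<^sub>R x1 t"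
      by (simp add: x1_def power2_eq_square mult_ac)
    ultimately show ?thesis by (simp add: algebra_simps)
  qed
  \<comment> \<open>The coefficients of \<open>x\<close> are compared after eliminating
    \<open>x1\<close> and \<open>x \<bullet> x\<close>: both sides become expressions in
    \<open>h\<close>, \<open>s\<close>, \<open>p \<bullet> p\<close> and
    \<open>x \<bullet> \<phi>\<close>.\<close>
  have eq: "g / h t - s1 t / (l\<^sup>2 * h t) = (1 / l\<^sup>2) * (g * sqrt (l\<^sup>2 - (norm (x t))\<^sup>2)
                       - (x t \<bullet> x1 t)\<^sup>2 / (l\<^sup>2 - (norm (x t))\<^sup>2)
                       - (norm (x1 t))\<^sup>2) + (x t \<bullet> \<phi> t) / l\<^sup>2" for t
  proof -
    have hh: "l\<^sup>2 - (norm (x t))\<^sup>2 = (h t)\<^sup>2" by (simp add: hx power2_norm_eq_inner)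
    have xx: "x t \<bullet> x t = l\<^sup>2 - (h t)\<^sup>2" by (simp add: hx)
    have a: "x t \<bullet> x1 t = s t * h t / l\<^sup>2"
      using hpos[of t] l by (simp add: x1_def inner_diff_right xx s_def[symmetric] field_simps power2_eq_square)
    have b: "x1 t \<bullet> p t = (p t \<bullet> p t - (s t)\<^sup>2 / l\<^sup>2) / h t"
      by (simp add: x1_def inner_diff_left s_def[symmetric] power2_eq_square)
    have c: "(norm (x1 t))\<^sup>2 = (p t \<bullet> p t - (s t)\<^sup>2 / l\<^sup>2 - (s t)\<^sup>2 * (h t)\<^sup>2 / l ^ 4) / (h t)\<^sup>2"
    proof -
      have "(norm (x1 t))\<^sup>2 = (1 / h t)\<^sup>2 * (p t \<bullet> p t - 2 * (s t / l\<^sup>2) * s t + (s t / l\<^sup>2)\<^sup>2 * (x t \<bullet> x t))"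
        unfolding power2_norm_eq_inner x1_def s_def
        by (simp add: inner_diff_left inner_diff_right inner_commute power2_eq_square algebra_simps)
      also have "\<dots> = (p t \<bullet> p t - (s t)\<^sup>2 / l\<^sup>2 - (s t)\<^sup>2 * (h t)\<^sup>2 / l ^ 4) / (h t)\<^sup>2"
        using hpos[of t] l unfolding xx by (simp add: field_simps power2_eq_square power4_eq_xxxx)
      finally show ?thesis .
    qed
    have d: "sqrt ((h t)\<^sup>2) = h t" using hpos[of t] by simp
    have h0: "h t \<noteq> 0" "l \<noteq> 0" using hpos[of t] l by auto
    show ?thesis
      unfolding hh a c d s1_def b inner_diff_right inner_scaleR_right xx
      using h0 by (simp add: field_simps power2_eq_square power4_eq_xxxx)
  qed
  show thesis
  proof
    show "norm (x t) < l" for t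
    proof (rule power2_less_imp_less)
      show "(norm (x t))\<^sup>2 < l\<^sup>2" using hx[of t] hpos[of t] zero_less_power[OF hpos[of t], of 2]
        by (simp add: power2_norm_eq_inner)
    qed (use l in simp)
    show "(x has_vector_derivative x1 t) (at t)" for t by (rule xD)
    have "(1 / h t) *\<^sub>R (g *\<^sub>R x t - h t *\<^sub>R \<phi> t - (s1 t / l\<^sup>2) *\<^sub>R x t)
        = (g / h t - s1 t / (l\<^sup>2 * h t)) *\<^sub>R x t - \<phi> t" for t
      using hpos[of t] by (simp add: algebra_simps)
    then show "(x1 has_vector_derivative
        ((1 / l\<^sup>2) * (g * sqrt (l\<^sup>2 - (norm (x t))\<^sup>2)
                       - (x t \<bullet> x1 t)\<^sup>2 / (l\<^sup>2 - (norm (x t))\<^sup>2)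
                       - (norm (x1 t))\<^sup>2)) *\<^sub>R x t
        + ((x t \<bullet> \<phi> t) / l\<^sup>2) *\<^sub>R x t - \<phi> t) (at t)" for t
      using x1D[of t] unfolding scaleR_add_left[symmetric] eq by simp
  qed
qed

section \<open>The periodic motion of the rod for the given motion of the car\<close>

theorem theorem1p2:
  fixes l g T :: real and f :: "real \<Rightarrow> real^2"
  assumes "l > 0" and "g > 0" and "T > 0"
    and "\<forall>t. f (t + T) = f t"
    and "C3_fun f"
  shows "\<exists>x x1 x2. C2_fun x x1 x2 \<and> (\<forall>t. x (t + T) = x t) \<and> (\<forall>t. norm (x t) < l) \<and>
     (\<forall>f1 f2. (\<forall>t. (f has_vector_derivative f1 t) (at t)) \<longrightarrow>
              (\<forall>t. (f1 has_vector_derivative f2 t) (at t)) \<longrightarrow>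
      (\<forall>t. x2 t =
        ((1 / l\<^sup>2) * (g * sqrt (l\<^sup>2 - (norm (x t))\<^sup>2)
                       - (x t \<bullet> x1 t)\<^sup>2 / (l\<^sup>2 - (norm (x t))\<^sup>2)
                       - (norm (x1 t))\<^sup>2)) *\<^sub>R x t
        + ((x t \<bullet> f2 t) / l\<^sup>2) *\<^sub>R x t - f2 t))"
proof -
  obtain u1 \<phi> u3 where u1: "\<And>t. (f has_vector_derivative u1 t) (at t)"
    and \<phi>: "\<And>t. (u1 has_vector_derivative \<phi> t) (at t)"
    and u3: "\<And>t. (\<phi> has_vector_derivative u3 t) (at t)"
    using assms(5) unfolding C3_fun_def by blast
  have c\<phi>: "continuous_on UNIV \<phi>"
    using u3 by (meson continuous_at_imp_continuous_on has_vector_derivative_continuous)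
  have "u1 (t + T) = u1 t" for t
    by (rule periodic_derivative[OF _ u1]) (use assms(4) in auto)
  then have per: "\<phi> (t + T) = \<phi> t" for t
    by (rule periodic_derivative[OF _ \<phi>])
  obtain y p where y': "\<And>t. (y has_vector_derivative (norm (1::real, y t) / l)\<^sup>2 *\<^sub>R p t) (at t)"
    and p': "\<And>t. (p has_vector_derivative (l / norm (1::real, y t)) *\<^sub>R (g *\<^sub>R y t - \<phi> t)) (at t)"
    and yT: "\<And>t. y (t + T) = y t"
    by (rule gnomonic_periodic_solution[OF assms(1-3) c\<phi> per]) (rule that)
  define x where "x t = (l / norm (1::real, y t)) *\<^sub>R y t" for t
  \<comment> \<open>The velocity is a parameter here because \<open>x1\<close> is obtained only
    afterwards; this lets the right-hand side of the equation be folded in the lemma that supplies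
    \<open>x1\<close>.\<close>
  define x2 where "x2 x1 t = ((1 / l\<^sup>2) * (g * sqrt (l\<^sup>2 - (norm (x t))\<^sup>2)
                       - (x t \<bullet> x1 t)\<^sup>2 / (l\<^sup>2 - (norm (x t))\<^sup>2)
                       - (norm (x1 t))\<^sup>2)) *\<^sub>R x t
        + ((x t \<bullet> \<phi> t) / l\<^sup>2) *\<^sub>R x t - \<phi> t" for x1 :: "real \<Rightarrow> real^2" and t
  obtain x1 where xl: "\<And>t. norm (x t) < l"
    and xD: "\<And>t. (x has_vector_derivative x1 t) (at t)"
    and x1D: "\<And>t. (x1 has_vector_derivative x2 x1 t) (at t)"
    by (rule pendulum_equation_of_gnomonic[OF assms(1) y' p', folded x_def, folded x2_def]) (rule that)
  have "continuous_on UNIV x" "continuous_on UNIV x1"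
    using xD x1D by (meson continuous_at_imp_continuous_on has_vector_derivative_continuous)+
  \<comment> \<open>The denominator never vanishes, so the acceleration is continuous and the
    solution of class C^2.\<close>
  moreover have "l\<^sup>2 - (norm (x t))\<^sup>2 \<noteq> 0" for t
    using power_strict_mono[OF xl[of t], of 2] by simp
  ultimately have "continuous_on UNIV (x2 x1)"
    unfolding x2_def using assms(1) by (intro continuous_intros c\<phi>) auto
  then have "C2_fun x x1 (x2 x1)"
    using xD x1D by (simp add: C2_fun_def)
  moreover have "x (t + T) = x t" for t by (simp add: x_def yT)
  \<comment> \<open>Derivatives are unique, so the equation proved for one choice of the derivatives
    of \<open>f\<close> holds for every admissible pair.\<close>
  moreover have "f2 = \<phi>"
    if f1: "\<forall>t. (f has_vector_derivative f1 t) (at t)" and f2: "\<forall>t. (f1 has_vector_derivative f2 t) (at t)"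
    for f1 f2
  proof -
    have f1_eq: "f1 = u1"
    proof
      show "f1 t = u1 t" for t using vector_derivative_unique_at[of f "f1 t" t "u1 t"] f1 u1 by simp
    qed
    show ?thesis
    proof
      show "f2 t = \<phi> t" for t using vector_derivative_unique_at[of u1 "f2 t" t "\<phi> t"] f2 \<phi> by (simp add: f1_eq)
    qed
  qed
  ultimately show ?thesis
    by (intro exI[of _ x] exI[of _ x1] exI[of _ "x2 x1"]) (simp add: xl x2_def)
qed

end
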